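(* Let $A$ be a unital algebra over an infinite field, and assume that $A$ has Bass stable rank one. Let $n\geq 3$. Then the following statements hold: (1) Every matrix in $\mathrm{GL}_n(A)$ is a product of three commutators in $M_n(A)$. (2) If $A$ is right K-Hermite, then every matrix in $M_n(A)$ is a product of three commutators in $M_n(A)$.
   Context: Algebras are associative and not necessarily commutative. The commutator of $x,y$ in a ring is the additive commutator $[x,y]=xy-yx$. $\mathrm{GL}_n(A)$ is the group of invertible matrices in $M_n(A)$. A unital ring $R$ has Bass stable rank one if for all $a,b\in R$ such that $R=Ra+Rb$, there exists $c\in R$ such that $R=R(a+cb)$. A unital ring $R$ is right K-Hermite if for all $x,y\in R$ there exist $Q\in \mathrm{GL}_2(R)$ and $z\in R$ such that $\begin{pmatrix} x & y\end{pmatrix}Q=\begin{pmatrix} z & 0\end{pmatrix}$. *)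

theory Defs
  imports Jordan_Normal_Form.Matrix
begin

locale unital_algebra = vector_space scale
  for scale :: "'k::field \<Rightarrow> 'a::ring_1 \<Rightarrow> 'a" (infixr \<open>*s\<close> 75) +
  assumes mult_scale_left: "(c *s x) * y = c *s (x * y)"
    and mult_scale_right: "x * (c *s y) = c *s (x * y)"

definition bass_stable_rank_one :: "'a::ring_1 itself \<Rightarrow> bool" where
  "bass_stable_rank_one _ \<longleftrightarrow>
    (\<forall>a b :: 'a. UNIV = {x * a + y * b | x y. True} \<longrightarrow>
      (\<exists>c. UNIV = {x * (a + c * b) | x. True}))"

definition GL_mat :: "nat \<Rightarrow> 'a::ring_1 mat set" where
  "GL_mat n = {M \<in> carrier_mat n n. invertible_mat M}"

definition right_K_Hermite :: "'a::ring_1 itself \<Rightarrow> bool" where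
  "right_K_Hermite _ \<longleftrightarrow>
    (\<forall>x y :: 'a. \<exists>Q \<in> GL_mat 2. \<exists>z.
      mat_of_rows_list 2 [[x, y]] * Q = mat_of_rows_list 2 [[z, 0]])"

definition mat_commutator :: "'a::ring_1 mat \<Rightarrow> 'a mat \<Rightarrow> 'a mat" where
  "mat_commutator X Y = X * Y - Y * X"

(* Matrices of different dimensions share one type, so membership in the n x n matrices
   has to be required of every factor. *)
definition mat_commutators :: "nat \<Rightarrow> 'a::ring_1 mat set" where
  "mat_commutators n =
    {mat_commutator X Y | X Y. X \<in> carrier_mat n n \<and> Y \<in> carrier_mat n n}"

definition product_of_three_commutators :: "nat \<Rightarrow> 'a::ring_1 mat \<Rightarrow> bool" where
  "product_of_three_commutators n M \<longleftrightarrow>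
    (\<exists>C1 \<in> mat_commutators n. \<exists>C2 \<in> mat_commutators n. \<exists>C3 \<in> mat_commutators n.
      M = C1 * C2 * C3)"

end

theory Submission
  imports Defs
begin

text \<open>
  Over an infinite field, every matrix with zero diagonal is a commutator \<open>[D, Y]\<close> with \<open>D\<close> diagonal
  with distinct scalar entries; over any ring, so is a lower triangular matrix whose diagonal sums to zero.
  Stable rank one gives \<open>G = U L V\<close> for every invertible \<open>G\<close>, with \<open>U, V\<close> upper triangular and \<open>L\<close> lower
  unitriangular, and the K-Hermite property gives \<open>M = S G\<close> for every \<open>M\<close>, with \<open>S\<close> upper triangular.
  Hence every matrix in question is conjugate to \<open>T L\<close> with \<open>T = V S U\<close> upper triangular.
  Writing \<open>T = T1 T2\<close> so that a suitable cyclic permutation matrix \<open>P\<close> makes the diagonals of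
  \<open>T1 P\<close> and \<open>P\<^sup>-\<^sup>1 T2\<close> vanish (this needs \<open>n \<ge> 3\<close>), one has
  \<open>T L = (T1 P) (P\<^sup>-\<^sup>1 T2 D\<^sup>-\<^sup>1) (D L)\<close> for any invertible scalar diagonal matrix \<open>D\<close> of trace zero,
  and all three factors are commutators.
\<close>

section \<open>Matrix inverses and conjugation\<close>

lemma mult_mat_entry:
  assumes "A \<in> carrier_mat m n" "B \<in> carrier_mat n p" "i < m" "j < p"
  shows "(A * B) $$ (i, j) = (\<Sum>k<n. A $$ (i, k) * B $$ (k, j))"
  using assms by (auto simp: scalar_prod_def lessThan_atLeast0)

lemma uminus_zero_mat: "- 0\<^sub>m m n = (0\<^sub>m m n :: 'a::group_add mat)"
  by (rule eq_matI) auto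

text \<open>The inverse is an explicit argument so that conjugations and block formulas can mention
  it. Both products are demanded because a one-sided inverse over a general ring need not be
  two-sided.\<close>

definition inverse_mats :: "nat \<Rightarrow> 'a::ring_1 mat \<Rightarrow> 'a mat \<Rightarrow> bool" where
  "inverse_mats n A B \<longleftrightarrow>
    A \<in> carrier_mat n n \<and> B \<in> carrier_mat n n \<and> A * B = 1\<^sub>m n \<and> B * A = 1\<^sub>m n"

lemma GL_mat_iff: "M \<in> GL_mat n \<longleftrightarrow> (\<exists>N. inverse_mats n M N)"
proof
  assume "M \<in> GL_mat n"
  then obtain N where M: "M \<in> carrier_mat n n" and MN: "M * N = 1\<^sub>m n" and NM: "N * M = 1\<^sub>m (dim_row N)"
    unfolding GL_mat_def invertible_mat_def inverts_mat_def by auto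
  \<comment> \<open>\<open>invertible_mat\<close> does not fix the size of \<open>N\<close>;
    comparing the column counts in both equations does.\<close>
  have "dim_row N = n" "dim_col N = n"
    using arg_cong[OF NM, of dim_col] arg_cong[OF MN, of dim_col] M by auto
  then show "\<exists>N. inverse_mats n M N"
    using M MN NM unfolding inverse_mats_def by auto
next
  assume "\<exists>N. inverse_mats n M N"
  then show "M \<in> GL_mat n"
    unfolding GL_mat_def invertible_mat_def inverts_mat_def inverse_mats_def square_mat.simps
    by force
qed

lemma mult_inverse_cancel:
  assumes "inverse_mats n A B" "X \<in> carrier_mat n m"
  shows "A * (B * X) = X" "B * (A * X) = X"
  using assms unfolding inverse_mats_def
  by (simp_all add: assoc_mult_mat[of _ n n _ n _ m, symmetric] del: assoc_mult_mat)

lemma inverse_mats_sym: "inverse_mats n A B \<Longrightarrow> inverse_mats n B A"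
  unfolding inverse_mats_def by auto

lemma inverse_mats_mult:
  assumes "inverse_mats n A A'" "inverse_mats n B B'"
  shows "inverse_mats n (A * B) (B' * A')"
proof -
  have c: "A \<in> carrier_mat n n" "A' \<in> carrier_mat n n" "B \<in> carrier_mat n n" "B' \<in> carrier_mat n n"
    using assms unfolding inverse_mats_def by auto
  have "A * B * (B' * A') = A * (B * (B' * A'))" "B' * A' * (A * B) = B' * (A' * (A * B))"
    using c by (auto intro!: assoc_mult_mat)
  then have "A * B * (B' * A') = 1\<^sub>m n" "B' * A' * (A * B) = 1\<^sub>m n"
    using c mult_inverse_cancel[OF assms(2), of A' n]
      mult_inverse_cancel[OF assms(1), of B n] assms
    unfolding inverse_mats_def by auto
  then show ?thesis
    using c unfolding inverse_mats_def by auto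
qed

text \<open>Conjugation by \<open>P\<close> is a ring automorphism of the \<open>n x n\<close>
  matrices, so it carries the commutator of \<open>X\<close> and \<open>Y\<close> to that of their
  conjugates.\<close>

lemma mat_commutators_conj:
  assumes PQ: "inverse_mats n P Q" and C: "C \<in> mat_commutators n"
  shows "P * C * Q \<in> mat_commutators n"
proof -
  from C obtain X Y where XY: "X \<in> carrier_mat n n" "Y \<in> carrier_mat n n" and C: "C = X * Y - Y * X"
    unfolding mat_commutators_def mat_commutator_def by auto
  note assoc = assoc_mult_mat[of _ n n _ n _ n] mult_carrier_mat[of _ n n _ n]
  have PQc: "P \<in> carrier_mat n n" "Q \<in> carrier_mat n n"
    using PQ unfolding inverse_mats_def by auto
  have conj: "(P * X * Q) * (P * Y * Q) = P * (X * Y) * Q"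
    if "X \<in> carrier_mat n n" "Y \<in> carrier_mat n n" for X Y
  proof -
    have "(P * X * Q) * (P * Y * Q) = P * (X * (Q * (P * (Y * Q))))"
      using that PQc by (simp add: assoc)
    also have "Q * (P * (Y * Q)) = Y * Q"
      using mult_inverse_cancel(2)[OF PQ, of "Y * Q" n] that PQc by auto
    finally show ?thesis using that PQc by (simp add: assoc)
  qed
  have XYc: "X * Y \<in> carrier_mat n n" "Y * X \<in> carrier_mat n n"
    using XY by auto
  have "P * C * Q = P * (X * Y) * Q - P * (Y * X) * Q"
    unfolding C mult_minus_distrib_mat[OF PQc(1) XYc]
    by (rule minus_mult_distrib_mat[of _ n n]) (use PQc XYc in auto)
  then have "P * C * Q = mat_commutator (P * X * Q) (P * Y * Q)"
    unfolding mat_commutator_def conj[OF XY] conj[OF XY(2,1)] .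
  moreover have "P * X * Q \<in> carrier_mat n n" "P * Y * Q \<in> carrier_mat n n"
    using XY PQc by auto
  ultimately show ?thesis
    unfolding mat_commutators_def by blast
qed

text \<open>Insert \<open>Q * P = 1\<close> between consecutive factors and conjugate each
  commutator separately.\<close>

lemma product_of_three_commutators_conj:
  assumes PQ: "inverse_mats n P Q" and M: "product_of_three_commutators n M"
  shows "product_of_three_commutators n (P * M * Q)"
proof -
  from M obtain A B C where ABC: "A \<in> mat_commutators n" "B \<in> mat_commutators n"
    "C \<in> mat_commutators n" and M: "M = A * B * C"
    unfolding product_of_three_commutators_def by auto
  note assoc = assoc_mult_mat[of _ n n _ n _ n] mult_carrier_mat[of _ n n _ n]
  have PQc: "P \<in> carrier_mat n n" "Q \<in> carrier_mat n n"
    using PQ unfolding inverse_mats_def by auto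
  have c: "A \<in> carrier_mat n n" "B \<in> carrier_mat n n" "C \<in> carrier_mat n n"
    using ABC unfolding mat_commutators_def mat_commutator_def by auto
  have "(P * A * Q) * (P * B * Q) * (P * C * Q) = P * (A * (Q * (P * (B * (Q * (P * (C * Q)))))))"
    using c PQc by (simp add: assoc)
  also have "Q * (P * (C * Q)) = C * Q"
    using mult_inverse_cancel(2)[OF PQ, of "C * Q" n] c PQc by auto
  also have "Q * (P * (B * (C * Q))) = B * (C * Q)"
    using mult_inverse_cancel(2)[OF PQ, of "B * (C * Q)" n] c PQc by auto
  also have "P * (A * (B * (C * Q))) = P * M * Q"
    using c PQc by (simp add: M assoc)
  finally show ?thesis
    unfolding product_of_three_commutators_def using mat_commutators_conj[OF PQ] ABC by metis
qed

section \<open>Two families of commutators\<close>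

text \<open>With \<open>K\<close> the lower shift, \<open>[Y, K] = Z\<close> reads
  \<open>Y (i, j + 1) - Y (i - 1, j) = Z (i, j)\<close>, which is solved along each diagonal.\<close>

lemma lower_triangular_trace_zero_commutator:
  fixes Z :: "'a::ring_1 mat"
  assumes Z: "Z \<in> carrier_mat n n"
    and lower: "\<And>i j. i < j \<Longrightarrow> j < n \<Longrightarrow> Z $$ (i, j) = 0"
    and trace: "(\<Sum>i<n. Z $$ (i, i)) = 0"
  shows "Z \<in> mat_commutators n"
proof -
  \<comment> \<open>The recursion unrolled towards the boundary: \<open>y i j\<close> is
    \<open>Z (i, j - 1) + Z (i - 1, j - 2) + ...\<close>, stopped when either index runs out. In
    particular column 0 is zero.\<close>
  define y where "y i j = (\<Sum>s<j. if s \<le> i then Z $$ (i - s, j - 1 - s) else 0)" for i j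
  define K :: "'a mat" where "K = mat n n (\<lambda>(i, j). if i = Suc j then 1 else 0)"
  define Y where "Y = mat n n (\<lambda>(i, j). y i j)"
  have y_0_Suc: "y 0 (Suc j) = Z $$ (0, j)" for j
    unfolding y_def by (simp add: sum.lessThan_Suc_shift del: sum.lessThan_Suc)
  have y_Suc_Suc: "y (Suc i) (Suc j) = Z $$ (Suc i, j) + y i j" for i j
    unfolding y_def by (subst sum.lessThan_Suc_shift) (auto intro!: sum.cong)
  \<comment> \<open>The last column of \<open>Y * K\<close> is zero, so the recursion requires
    \<open>y i n = 0\<close>. For \<open>i = n - 1\<close> the sum is the trace of \<open>Z\<close>;
    for smaller \<open>i\<close> it runs over entries above the diagonal.\<close>
  have y_last: "y i n = 0" if "i < n" for i
  proof (cases "i = n - 1")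
    case True
    have "y i n = (\<Sum>s<n. Z $$ (n - Suc s, n - Suc s))"
      unfolding y_def using True by (auto intro!: sum.cong)
    also have "\<dots> = (\<Sum>i<n. Z $$ (i, i))"
      by (rule sum.nat_diff_reindex)
    finally show ?thesis using trace by simp
  next
    case False
    with that have "Z $$ (i - s, n - 1 - s) = 0" if "s < n" "s \<le> i" for s
      using that by (intro lower) auto
    then show ?thesis unfolding y_def
      by (intro sum.neutral) auto
  qed
  have "Z = mat_commutator Y K"
  proof (rule eq_matI)
    fix i j
    assume "i < dim_row (mat_commutator Y K)" "j < dim_col (mat_commutator Y K)"
    then have ij: "i < n" "j < n"
      unfolding mat_commutator_def K_def Y_def by auto
    have "(Y * K) $$ (i, j) = (\<Sum>k<n. if k = Suc j then y i k else 0)"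
      using ij by (subst mult_mat_entry[of _ n n _ n])
        (auto simp: K_def Y_def simp del: sum.delta intro!: sum.cong)
    also have "\<dots> = y i (Suc j)"
      using ij y_last[of i] by (cases "Suc j = n") (auto simp: sum.delta)
    finally have YK: "(Y * K) $$ (i, j) = y i (Suc j)" .
    have "(K * Y) $$ (i, j) = (\<Sum>k<n. if i = Suc k then y k j else 0)"
      using ij by (subst mult_mat_entry[of _ n n _ n])
        (auto simp: K_def Y_def simp del: sum.delta intro!: sum.cong)
    also have "\<dots> = (case i of 0 \<Rightarrow> 0 | Suc k \<Rightarrow> y k j)"
      using ij by (cases i) (auto simp: sum.delta)
    finally have KY: "(K * Y) $$ (i, j) = (case i of 0 \<Rightarrow> 0 | Suc k \<Rightarrow> y k j)" .
    have "mat_commutator Y K $$ (i, j) = (Y * K) $$ (i, j) - (K * Y) $$ (i, j)"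
      unfolding mat_commutator_def using ij by (simp add: K_def Y_def)
    then show "Z $$ (i, j) = mat_commutator Y K $$ (i, j)"
      unfolding YK KY by (cases i) (auto simp: y_0_Suc y_Suc_Suc)
  qed (use Z in \<open>auto simp: mat_commutator_def K_def Y_def\<close>)
  moreover have "Y \<in> carrier_mat n n" "K \<in> carrier_mat n n"
    unfolding K_def Y_def by auto
  ultimately show ?thesis
    unfolding mat_commutators_def by auto
qed

context unital_algebra
begin

text \<open>Scalars are central, so commutation with \<open>D\<close> multiplies entry
  \<open>(i, j)\<close> of \<open>Y\<close> by \<open>d i - d j\<close>. Injectivity of
  \<open>d\<close> makes this factor invertible off the diagonal; on the diagonal both sides are
  zero.\<close>

lemma zero_diagonal_commutator:
  fixes Z :: "'a mat"
  assumes inf: "infinite (UNIV :: 'k set)"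
    and Z: "Z \<in> carrier_mat n n"
    and diag: "\<And>i. i < n \<Longrightarrow> Z $$ (i, i) = 0"
  shows "Z \<in> mat_commutators n"
proof -
  obtain d :: "nat \<Rightarrow> 'k" where d: "inj d"
    using infinite_countable_subset[OF inf] by auto
  define D where "D = mat_diag n (\<lambda>i. d i *s (1 :: 'a))"
  define Y where "Y = mat n n (\<lambda>(i, j). inverse (d i - d j) *s Z $$ (i, j))"
  have Y: "Y \<in> carrier_mat n n" unfolding Y_def by auto
  have "Z = mat_commutator D Y"
  proof (rule eq_matI)
    fix i j
    assume "i < dim_row (mat_commutator D Y)" "j < dim_col (mat_commutator D Y)"
    then have ij: "i < n" "j < n"
      unfolding mat_commutator_def D_def Y_def by (auto simp: mat_diag_def)
    have "mat_commutator D Y $$ (i, j) = (d i - d j) *s Y $$ (i, j)"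
      unfolding mat_commutator_def D_def mat_diag_mult_left[OF Y] mat_diag_mult_right[OF Y]
      using ij by (simp add: mult_scale_left mult_scale_right scale_left_diff_distrib)
    also have "\<dots> = Z $$ (i, j)"
      using ij diag[of i] d by (cases "i = j") (auto simp: Y_def inj_eq)
    finally show "Z $$ (i, j) = mat_commutator D Y $$ (i, j)" ..
  qed (use Z Y in \<open>auto simp: mat_commutator_def D_def mat_diag_def\<close>)
  moreover have "D \<in> carrier_mat n n"
    unfolding D_def by auto
  ultimately show ?thesis
    unfolding mat_commutators_def using Y by auto
qed

lemma ex_nonzero_sum_zero:
  assumes inf: "infinite (UNIV :: 'k set)" and n: "n \<ge> 2"
  obtains d :: "nat \<Rightarrow> 'k" where "\<And>i. d i \<noteq> 0" "(\<Sum>i<n. d i) = 0"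
proof -
  obtain m where m: "n = Suc (Suc m)"
    using n by (metis add_2_eq_Suc le_Suc_ex)
  \<comment> \<open>The values \<open>c\<close>, \<open>- m - c\<close> and then \<open>m\<close>
    ones add up to zero in every characteristic. The excluded values of \<open>c\<close> are those
    for which one of the first two would vanish.\<close>
  obtain c :: 'k where c: "c \<notin> {0, - of_nat m}"
    using ex_new_if_finite[OF inf, of "{0, - of_nat m}"] by auto
  define d where "d i = (if i = 0 then c else if i = 1 then - of_nat m - c else 1)" for i :: nat
  have "(\<Sum>i<n. d i) = d 0 + (d 1 + (\<Sum>i<m. d (Suc (Suc i))))"
    unfolding m by (simp only: sum.lessThan_Suc_shift One_nat_def)
  then have "(\<Sum>i<n. d i) = 0"
    by (simp add: d_def)
  moreover have "d i \<noteq> 0" for i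
    using c by (auto simp: d_def)
  ultimately show thesis using that by blast
qed

section \<open>Upper triangular times lower unitriangular\<close>

lemma upper_times_lower_three_commutators:
  fixes T :: "'a mat"
  assumes inf: "infinite (UNIV :: 'k set)" and n: "n \<ge> 3"
    and T: "T \<in> carrier_mat n n" and upper: "upper_triangular T"
    and L: "L \<in> carrier_mat n n"
    and L_diag: "\<And>i. i < n \<Longrightarrow> L $$ (i, i) = 1"
    and L_lower: "\<And>i j. i < j \<Longrightarrow> j < n \<Longrightarrow> L $$ (i, j) = 0"
  shows "product_of_three_commutators n (T * L)"
proof -
  obtain d :: "nat \<Rightarrow> 'k" where d: "\<And>i. d i \<noteq> 0" "(\<Sum>i<n. d i) = 0"
    using ex_nonzero_sum_zero[OF inf, of n] n by auto
  define D where "D = mat_diag n (\<lambda>i. d i *s (1 :: 'a))"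
  define E where "E = mat_diag n (\<lambda>i. inverse (d i) *s (1 :: 'a))"
  have DE: "D \<in> carrier_mat n n" "E \<in> carrier_mat n n"
    unfolding D_def E_def by auto
  have ED: "E * D = 1\<^sub>m n"
    unfolding E_def D_def mat_diag_mult_left[OF mat_diag_dim]
    by (rule eq_matI) (use d in \<open>auto simp: mat_diag_def mult_scale_left mult_scale_right\<close>)
  \<comment> \<open>\<open>T = T1 T2\<close>, with \<open>p\<close> a cyclic permutation matrix \<open>P\<close> inserted between the factors:
    \<open>C1 = T1 P\<close> and \<open>C2 = P\<^sup>-\<^sup>1 T2 E\<close>. Row 1 of \<open>C2\<close> is row 0 of \<open>T2 E\<close>, whose entry in
    column 1 vanishes because \<open>n - 1 \<noteq> 1\<close>.\<close>
  define p where "p k = (if k = 0 then n - 1 else k - 1)" for k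
  define T1 where "T1 i j = (if i = 0 then if j = 0 then 1 else if j = n - 1 then 0 else T $$ (0, j)
      else T $$ (i, j))" for i j
  define T2 where "T2 i j = (if i = 0 then if j = 0 \<or> j = n - 1 then T $$ (0, j) else 0
      else if i = j then 1 else 0)" for i j
  define C1 where "C1 = mat n n (\<lambda>(i, j). T1 i (p j))"
  define C2 where "C2 = mat n n (\<lambda>(i, j). T2 (p i) j * (inverse (d j) *s 1))"
  define C3 where "C3 = D * L"
  have C12: "C1 \<in> carrier_mat n n" "C2 \<in> carrier_mat n n"
    unfolding C1_def C2_def by auto
  have T0: "T $$ (i, j) = 0" if "j < i" "i < n" for i j
    using upper_triangularD[OF upper that(1)] that(2) T by auto
  have p: "bij_betw p {..<n} {..<n}"
    by (rule bij_betw_byWitness[where f' = "\<lambda>k. if k = n - 1 then 0 else Suc k"])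
      (use n in \<open>auto simp: p_def\<close>)
  \<comment> \<open>Position \<open>(0, 0)\<close> receives the entry \<open>(0, n - 1)\<close> of
    \<open>T1\<close>, which was set to zero; each later diagonal position receives a subdiagonal
    entry of \<open>T\<close>.\<close>
  have "C1 $$ (i, i) = 0" if "i < n" for i
    using that n by (auto simp: C1_def T1_def p_def T0)
  then have C1_comm: "C1 \<in> mat_commutators n"
    by (rule zero_diagonal_commutator[OF inf C12(1)])
  have "C2 $$ (i, i) = 0" if "i < n" for i
    using that n by (auto simp: C2_def T2_def p_def)
  then have C2_comm: "C2 \<in> mat_commutators n"
    by (rule zero_diagonal_commutator[OF inf C12(2)])
  have C3_eq: "C3 = mat n n (\<lambda>(i, j). d i *s L $$ (i, j))"
    unfolding C3_def D_def mat_diag_mult_left[OF L] by (simp add: mult_scale_left)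
  have C3_comm: "C3 \<in> mat_commutators n"
  proof (rule lower_triangular_trace_zero_commutator)
    have "(\<Sum>i<n. C3 $$ (i, i)) = (\<Sum>i<n. d i) *s 1"
      unfolding scale_sum_left by (rule sum.cong) (auto simp: C3_eq L_diag)
    then show "(\<Sum>i<n. C3 $$ (i, i)) = 0"
      using d(2) by simp
  qed (auto simp: C3_eq L_lower)
  have "C1 * C2 = T * E"
  proof (rule eq_matI)
    fix i j
    assume "i < dim_row (T * E)" "j < dim_col (T * E)"
    then have ij: "i < n" "j < n"
      using T DE by auto
    obtain m where m: "n = Suc m" using n by (cases n) auto
    have "(C1 * C2) $$ (i, j) = (\<Sum>k<n. T1 i (p k) * (T2 (p k) j * (inverse (d j) *s 1)))"
      using ij by (subst mult_mat_entry[OF C12]) (auto simp: C1_def C2_def)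
    \<comment> \<open>Reindexing along the bijection \<open>p\<close> cancels the permutation matrix
      against its inverse.\<close>
    also have "\<dots> = (\<Sum>k<n. T1 i k * (T2 k j * (inverse (d j) *s 1)))"
      by (rule sum.reindex_bij_betw[OF p])
    also have "\<dots> = (\<Sum>k<n. T1 i k * T2 k j) * (inverse (d j) *s 1)"
      by (simp add: sum_distrib_right mult.assoc)
    \<comment> \<open>Below row 0, \<open>T2\<close> agrees with the identity, so besides
      \<open>k = 0\<close> only the index equal to \<open>j\<close> contributes.\<close>
    also have "(\<Sum>k<n. T1 i k * T2 k j) = T1 i 0 * T2 0 j + (\<Sum>k<m. if j = Suc k then T1 i j else 0)"
      unfolding m by (subst sum.lessThan_Suc_shift) (auto simp: T2_def intro!: sum.cong)
    also have "\<dots> = T $$ (i, j)"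
      using ij T0[of 0 i] m by (cases j) (auto simp: T1_def T2_def)
    finally show "(C1 * C2) $$ (i, j) = (T * E) $$ (i, j)"
      using ij by (simp add: E_def mat_diag_mult_right[OF T])
  qed (use C12 T DE in auto)
  then have "C1 * C2 * C3 = T * (E * (D * L))"
    unfolding C3_def using T DE L by (simp add: assoc_mult_mat[of _ n n _ n _ n])
  also have "E * (D * L) = L"
    using DE L ED by (simp add: assoc_mult_mat[of _ n n _ n _ n, symmetric])
  finally show ?thesis
    unfolding product_of_three_commutators_def using C1_comm C2_comm C3_comm by metis
qed

end

section \<open>Units in rings of stable rank one\<close>

lemma stable_rank_one_left_invertible:
  fixes a b :: "'a::ring_1"
  assumes sr: "bass_stable_rank_one TYPE('a)" and "x * a + y * b = 1"
  obtains c w where "w * (a + c * b) = 1"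
proof -
  have "z = (z * x) * a + (z * y) * b" for z
    using arg_cong[OF assms(2), of "(*) z"] by (simp add: algebra_simps)
  then have "UNIV = {s * a + t * b | s t. True}"
    by blast
  then obtain c where "UNIV = {s * (a + c * b) | s. True}"
    using sr[unfolded bass_stable_rank_one_def, rule_format] by blast
  then have "1 \<in> {s * (a + c * b) | s. True}"
    by blast
  then obtain w where "w * (a + c * b) = 1" by auto
  then show thesis by (rule that)
qed

text \<open>Stable rank one applied to \<open>x\<close> and \<open>1 - u * x\<close> gives a left
  invertible \<open>v = x + c * (1 - u * x)\<close>. Since \<open>1 - u * x\<close> kills
  \<open>u\<close> from the left, also \<open>v * u = 1\<close>. Hence the left inverse of
  \<open>v\<close> is \<open>u\<close>, and \<open>u * v = 1\<close> forces
  \<open>x = v\<close>.\<close>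

lemma stable_rank_one_Dedekind_finite:
  fixes u x :: "'a::ring_1"
  assumes sr: "bass_stable_rank_one TYPE('a)" and xu: "x * u = 1"
  shows "u * x = 1"
proof -
  have "u * x + 1 * (1 - u * x) = 1" by simp
  then obtain c w where wv: "w * (x + c * (1 - u * x)) = 1"
    using stable_rank_one_left_invertible[OF sr] by blast
  define v where "v = x + c * (1 - u * x)"
  have "u * x * u = u"
    using xu by (simp add: mult.assoc)
  then have vu: "v * u = 1"
    unfolding v_def using xu by (simp add: algebra_simps)
  have "w = w * (v * u)" using vu by simp
  also have "\<dots> = u" using wv by (simp add: v_def mult.assoc[symmetric])
  finally have uv: "u * v = 1" using wv by (simp add: v_def)
  have "x = x * (u * v)" using uv by simp
  also have "\<dots> = v" using xu by (simp add: mult.assoc[symmetric])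
  finally show ?thesis using uv by simp
qed

lemma stable_rank_one_unit:
  fixes a b :: "'a::ring_1"
  assumes "bass_stable_rank_one TYPE('a)" and "x * a + y * b = 1"
  obtains c w where "w * (a + c * b) = 1" "(a + c * b) * w = 1"
  using stable_rank_one_left_invertible[OF assms] stable_rank_one_Dedekind_finite[OF assms(1)]
  by metis

section \<open>Inverses of block triangular matrices\<close>

lemma four_block_mat_inject:
  assumes "A \<in> carrier_mat m p" "B \<in> carrier_mat m q" "C \<in> carrier_mat n p" "D \<in> carrier_mat n q"
    and "A' \<in> carrier_mat m p" "B' \<in> carrier_mat m q" "C' \<in> carrier_mat n p" "D' \<in> carrier_mat n q"
    and eq: "four_block_mat A B C D = four_block_mat A' B' C' D'"
  shows "A = A'" "B = B'" "C = C'" "D = D'"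
proof -
  note * = arg_cong[OF eq, of "\<lambda>M. M $$ (i, j)" for i j]
  show "A = A'" "B = B'" "C = C'" "D = D'"
    subgoal
    proof (rule eq_matI)
      fix i j assume "i < dim_row A'" "j < dim_col A'"
      then show "A $$ (i, j) = A' $$ (i, j)" using assms(1-8) *[of i j] by auto
    qed (use assms in auto)
    subgoal
    proof (rule eq_matI)
      fix i j assume "i < dim_row B'" "j < dim_col B'"
      then show "B $$ (i, j) = B' $$ (i, j)" using assms(1-8) *[of i "p + j"] by auto
    qed (use assms in auto)
    subgoal
    proof (rule eq_matI)
      fix i j assume "i < dim_row C'" "j < dim_col C'"
      then show "C $$ (i, j) = C' $$ (i, j)" using assms(1-8) *[of "m + i" j] by auto
    qed (use assms in auto)
    subgoal
    proof (rule eq_matI)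
      fix i j assume "i < dim_row D'" "j < dim_col D'"
      then show "D $$ (i, j) = D' $$ (i, j)" using assms(1-8) *[of "m + i" "p + j"] by auto
    qed (use assms in auto)
    done
qed

lemma inverse_mats_upper_block:
  assumes "inverse_mats m A A'" "inverse_mats n D D'" "B \<in> carrier_mat m n"
  shows "inverse_mats (m + n) (four_block_mat A B (0\<^sub>m n m) D)
    (four_block_mat A' (- (A' * B * D')) (0\<^sub>m n m) D')"
proof -
  have c: "A \<in> carrier_mat m m" "A' \<in> carrier_mat m m" "D \<in> carrier_mat n n" "D' \<in> carrier_mat n n"
    "A * A' = 1\<^sub>m m" "A' * A = 1\<^sub>m m" "D * D' = 1\<^sub>m n" "D' * D = 1\<^sub>m n"
    using assms unfolding inverse_mats_def by auto
  have N: "- (A' * B * D') \<in> carrier_mat m n" using c assms by auto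
  have "A * (A' * B * D') = B * D'"
    using c assms mult_inverse_cancel(1)[OF assms(1), of "B * D'" n]
    by (simp add: assoc_mult_mat[of _ m m _ n _ n])
  then have e1: "A * - (A' * B * D') + B * D' = 0\<^sub>m m n"
    using c assms by (simp add: uminus_mult_right_mat)
  have "A' * B * D' * D = A' * B * (D' * D)"
    using c assms by (intro assoc_mult_mat[of _ m n _ n _ n]) auto
  then have "A' * B * D' * D = A' * B"
    using c assms by simp
  then have e2: "A' * B + - (A' * B * D') * D = 0\<^sub>m m n"
    using c assms by (simp add: uminus_mult_left_mat add_uminus_minus_mat[of _ m n])
  show ?thesis
    unfolding inverse_mats_def
    using c assms(3) N e1 e2
    by (simp add: uminus_zero_mat mult_four_block_mat[of _ m m _ n _ n _ _ m _ n])
qed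

lemma inverse_mats_lower_block:
  fixes C :: "'a::ring_1 mat"
  assumes "C \<in> carrier_mat n m"
  shows "inverse_mats (m + n) (four_block_mat (1\<^sub>m m) (0\<^sub>m m n) C (1\<^sub>m n))
    (four_block_mat (1\<^sub>m m) (0\<^sub>m m n) (- C) (1\<^sub>m n))"
proof -
  have "C + - C = 0\<^sub>m n m" "- C + C = 0\<^sub>m n m"
    using assms by (auto intro!: eq_matI)
  then show ?thesis
    unfolding inverse_mats_def using assms
    by (simp add: uminus_zero_mat mult_four_block_mat[of _ m m _ n _ n _ _ m _ n])
qed

text \<open>Over a general ring, invertibility of a block triangular matrix does not pass to its
  diagonal blocks. Here invertibility of \<open>A\<close> forces the lower left block
  \<open>R\<close> of the inverse to vanish, after which \<open>S\<close> is a two-sided inverse of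
  \<open>D\<close>.\<close>

lemma inverse_mats_upper_blockD:
  assumes inv: "inverse_mats (m + n) (four_block_mat A B (0\<^sub>m n m) D) H"
    and A: "inverse_mats m A A'" and B: "B \<in> carrier_mat m n" and D: "D \<in> carrier_mat n n"
  shows "\<exists>D'. inverse_mats n D D'"
proof -
  obtain P Q R S where sp: "split_block H m m = (P, Q, R, S)"
    by (cases "split_block H m m") auto
  have "dim_row H = m + n" "dim_col H = m + n"
    using inv unfolding inverse_mats_def by auto
  note H = split_block[OF sp this]
  have c: "A \<in> carrier_mat m m" "A' \<in> carrier_mat m m" "A * A' = 1\<^sub>m m"
    using A unfolding inverse_mats_def by auto
  have "four_block_mat (A * P + B * R) (A * Q + B * S) (0\<^sub>m n m * P + D * R) (0\<^sub>m n m * Q + D * S)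
      = four_block_mat (1\<^sub>m m) (0\<^sub>m m n) (0\<^sub>m n m) (1\<^sub>m n)"
    using inv c B D H(1-4) unfolding inverse_mats_def H(5)
    by (simp add: mult_four_block_mat[of _ m m _ n _ n _ _ m _ n])
  from four_block_mat_inject(4)[OF _ _ _ _ _ _ _ _ this, of m m n n]
  have DS: "D * S = 1\<^sub>m n"
    using c B D H(1-4) by simp
  have "four_block_mat (P * A + Q * 0\<^sub>m n m) (P * B + Q * D) (R * A + S * 0\<^sub>m n m) (R * B + S * D)
      = four_block_mat (1\<^sub>m m) (0\<^sub>m m n) (0\<^sub>m n m) (1\<^sub>m n)"
    using inv c B D H(1-4) unfolding inverse_mats_def H(5)
    by (simp add: mult_four_block_mat[of _ m m _ n _ n _ _ m _ n])
  note inj = four_block_mat_inject(3,4)[OF _ _ _ _ _ _ _ _ this, of m m n n]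
  have RA: "R * A = 0\<^sub>m n m" and RS: "R * B + S * D = 1\<^sub>m n"
    using inj c B D H(1-4) by simp_all
  have "R = R * (A * A')" using c H by simp
  also have "\<dots> = (R * A) * A'" using c H by (simp add: assoc_mult_mat[of _ n m _ m _ m])
  finally have "R = 0\<^sub>m n m" using c RA by simp
  then have "S * D = 1\<^sub>m n" using RS B D H(1-4) by simp
  then show ?thesis using DS D H(1-4) unfolding inverse_mats_def by blast
qed

section \<open>Factorization of invertible matrices under stable rank one\<close>

text \<open>Induction on the size: a row operation makes the corner entry a unit, the column below
  it is cleared, and the induction hypothesis is applied to the Schur complement.\<close>

lemma GL_upper_lower_upper:
  fixes G :: "'a::ring_1 mat"
  assumes sr: "bass_stable_rank_one TYPE('a)"
  shows "inverse_mats n G H \<Longrightarrow> \<exists>U U' L V V'. inverse_mats n U U' \<and> upper_triangular U \<and>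
    L \<in> carrier_mat n n \<and> (\<forall>i<n. L $$ (i, i) = 1) \<and> (\<forall>i j. i < j \<and> j < n \<longrightarrow> L $$ (i, j) = 0) \<and>
    inverse_mats n V V' \<and> upper_triangular V \<and> G = U * L * V"
proof (induction n arbitrary: G H)
  case 0
  then have "G = 1\<^sub>m 0" unfolding inverse_mats_def by auto
  then show ?case
    by (intro exI[of _ "1\<^sub>m 0"]) (auto simp: inverse_mats_def)
next
  case (Suc n)
  have Gc: "G \<in> carrier_mat (1 + n) (1 + n)" "H \<in> carrier_mat (1 + n) (1 + n)" and HG: "H * G = 1\<^sub>m (1 + n)"
    using Suc.prems unfolding inverse_mats_def by auto
  obtain a r c D where spG: "split_block G 1 1 = (a, r, c, D)"
    by (cases "split_block G 1 1") auto
  obtain p q s t where spH: "split_block H 1 1 = (p, q, s, t)"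
    by (cases "split_block H 1 1") auto
  have dims: "dim_row G = 1 + n" "dim_col G = 1 + n" "dim_row H = 1 + n" "dim_col H = 1 + n"
    using Gc by auto
  note G = split_block[OF spG dims(1,2)]
  note H = split_block[OF spH dims(3,4)]
  have "four_block_mat (p * a + q * c) (p * r + q * D) (s * a + t * c) (s * r + t * D)
      = four_block_mat (1\<^sub>m 1) (0\<^sub>m 1 n) (0\<^sub>m n 1) (1\<^sub>m n)"
    using HG G(1-4) H(1-4) unfolding G(5) H(5)
    by (simp add: mult_four_block_mat[of _ 1 1 _ n _ n _ _ 1 _ n] del: One_nat_def)
  from four_block_mat_inject(1)[OF _ _ _ _ _ _ _ _ this, of 1 1 n n]
  have paqc: "p * a + q * c = 1\<^sub>m 1"
    using G(1-4) H(1-4) by simp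
  \<comment> \<open>The product \<open>q * c\<close> of row and column is a single ring element, so
    the two-element condition suffices for a first column of any length.\<close>
  have "p $$ (0, 0) * a $$ (0, 0) + 1 * (q * c) $$ (0, 0) = 1"
    using arg_cong[OF paqc, of "\<lambda>M. M $$ (0, 0)"] G(1-4) H(1-4)
    by (simp add: scalar_prod_def)
  from stable_rank_one_unit[OF sr this] obtain k w where
    kw: "w * (a $$ (0, 0) + k * (q * c) $$ (0, 0)) = 1"
      "(a $$ (0, 0) + k * (q * c) $$ (0, 0)) * w = 1" .
  \<comment> \<open>Adding \<open>e\<close> times the lower rows to the first row turns the corner
    \<open>a\<close> into the unit \<open>u\<close>.\<close>
  define e where "e = k \<cdot>\<^sub>m q"
  define u where "u = a + e * c"
  define W where "W = mat 1 1 (\<lambda>_. w)"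
  define r' where "r' = r + e * D"
  \<comment> \<open>The Schur complement of \<open>u\<close>, with \<open>W\<close> the inverse of
    \<open>u\<close>.\<close>
  define D' where "D' = D - c * W * r'"
  have c: "e \<in> carrier_mat 1 n" "u \<in> carrier_mat 1 1" "W \<in> carrier_mat 1 1"
    "r' \<in> carrier_mat 1 n" "D' \<in> carrier_mat n n"
    unfolding e_def u_def W_def r'_def D'_def using G(1-4) H(1-4) by auto
  have u00: "u $$ (0, 0) = a $$ (0, 0) + k * (q * c) $$ (0, 0)"
    unfolding u_def e_def using G(1-4) H(1-4)
    by (simp add: scalar_prod_def sum_distrib_left mult.assoc)
  have uW: "inverse_mats 1 u W"
    unfolding inverse_mats_def using c kw u00
    by (auto intro!: eq_matI simp: scalar_prod_def W_def)
  have D'_add: "c * W * r' + D' = D"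
    unfolding D'_def using G(1-4) c by (intro eq_matI) auto
  have cWu: "c * W * u = c"
    using G(1-4) c uW unfolding inverse_mats_def
    by (simp add: assoc_mult_mat[of _ n 1 _ 1 _ 1])
  define E where "E = four_block_mat (1\<^sub>m 1) e (0\<^sub>m n 1) (1\<^sub>m n)"
  define F where "F = four_block_mat (1\<^sub>m 1) (0\<^sub>m 1 n) (c * W) (1\<^sub>m n)"
  define F' where "F' = four_block_mat (1\<^sub>m 1) (0\<^sub>m 1 n) (- (c * W)) (1\<^sub>m n)"
  define K where "K = four_block_mat u r' (0\<^sub>m n 1) D'"
  have one: "inverse_mats m (1\<^sub>m m) (1\<^sub>m m :: 'a mat)" for m
    unfolding inverse_mats_def by auto
  obtain E' where E: "inverse_mats (1 + n) E E'"
    using inverse_mats_upper_block[OF one[of 1] one[of n] c(1)] unfolding E_def by blast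
  have F: "inverse_mats (1 + n) F' F"
    using inverse_mats_lower_block[of "c * W" n 1] G(1-4) c inverse_mats_sym unfolding F_def F'_def by auto
  have Kc: "K \<in> carrier_mat (1 + n) (1 + n)" unfolding K_def by (rule four_block_carrier_mat[OF c(2,5)])
  have EG: "E * G = four_block_mat u r' c D"
    unfolding E_def G(5) using G(1-4) c u_def r'_def
    by (simp add: mult_four_block_mat[of _ 1 1 _ n _ n _ _ 1 _ n] del: One_nat_def)
  have FK: "F * K = four_block_mat u r' c D"
    unfolding F_def K_def using G(1-4) c D'_add cWu
    by (simp add: mult_four_block_mat[of _ 1 1 _ n _ n _ _ 1 _ n] del: One_nat_def)
  \<comment> \<open>\<open>K\<close> is a product of invertible matrices with invertible corner
    \<open>u\<close>, so its other diagonal block \<open>D'\<close> is invertible too.\<close>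
  have "K = F' * (E * G)"
    using mult_inverse_cancel(1)[OF F Kc] unfolding FK EG ..
  moreover have "inverse_mats (1 + n) (F' * (E * G)) ((H * E') * F)"
    using Suc.prems E F by (intro inverse_mats_mult) auto
  ultimately obtain D'' where "inverse_mats n D' D''"
    using inverse_mats_upper_blockD[OF _ uW c(4,5)] unfolding K_def by metis
  from Suc.IH[OF this] obtain U U' L V V' where IH: "inverse_mats n U U'" "upper_triangular U"
    "L \<in> carrier_mat n n" "\<And>i. i < n \<Longrightarrow> L $$ (i, i) = 1"
    "\<And>i j. i < j \<Longrightarrow> j < n \<Longrightarrow> L $$ (i, j) = 0"
    "inverse_mats n V V'" "upper_triangular V" "D' = U * L * V"
    by blast
  have UV: "U \<in> carrier_mat n n" "U' \<in> carrier_mat n n" "V \<in> carrier_mat n n" "V' \<in> carrier_mat n n"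
    using IH unfolding inverse_mats_def by auto
  \<comment> \<open>Here \<open>G\<close> is the inverse of \<open>E\<close> times
    \<open>F * K\<close>, and \<open>K\<close> contains \<open>D' = U * L * V\<close>. Pulling
    \<open>diag(1, U)\<close> to the left through \<open>F\<close> replaces \<open>c * W\<close> by
    \<open>U' * (c * W)\<close>; merging it with the inverse of \<open>E\<close> gives
    \<open>U1\<close>.\<close>
  define U1 where "U1 = four_block_mat (1\<^sub>m 1) (- (e * U)) (0\<^sub>m n 1) U"
  define L1 where "L1 = four_block_mat (1\<^sub>m 1) (0\<^sub>m 1 n) (U' * (c * W)) L"
  define V1 where "V1 = four_block_mat u r' (0\<^sub>m n 1) V"
  obtain U1' where U1: "inverse_mats (1 + n) U1 U1'"
    using inverse_mats_upper_block[OF one[of 1] IH(1), of "- (e * U)"] c UV unfolding U1_def by auto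
  obtain V1' where V1: "inverse_mats (1 + n) V1 V1'"
    using inverse_mats_upper_block[OF uW IH(6), of r'] c UV unfolding V1_def by auto
  have tri1: "upper_triangular U1"
    unfolding U1_def by (rule upper_triangular_four_block[of _ 1 _ n]) (use UV IH in auto)
  have tri2: "upper_triangular V1"
    unfolding V1_def by (rule upper_triangular_four_block[of _ 1 _ n]) (use UV IH c in auto)
  have L1c: "L1 \<in> carrier_mat (1 + n) (1 + n)"
    unfolding L1_def by (rule four_block_carrier_mat[OF one_carrier_mat IH(3)])
  have L1_diag: "\<forall>i<Suc n. L1 $$ (i, i) = 1"
    unfolding L1_def using IH(3,4) by auto
  have L1_lower: "\<forall>i j. i < j \<and> j < Suc n \<longrightarrow> L1 $$ (i, j) = 0"
    unfolding L1_def using IH(3,5) by auto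
  have LV: "L1 * V1 = four_block_mat u r' (U' * c) (U' * (c * W * r') + L * V)"
  proof -
    have "U' * (c * W) * u = U' * c"
      using cWu G(1-4) c UV by (simp add: assoc_mult_mat[of _ n n _ 1 _ 1])
    moreover have "U' * (c * W) * r' = U' * (c * W * r')"
      using G(1-4) c UV by (intro assoc_mult_mat[of _ n n _ 1 _ n]) auto
    ultimately show ?thesis
      unfolding L1_def V1_def using G(1-4) c UV IH(3)
      by (simp add: mult_four_block_mat[of _ 1 1 _ n _ n _ _ 1 _ n] del: One_nat_def)
  qed
  have "U * (U' * c) = c"
    by (rule mult_inverse_cancel[OF IH(1) G(3)])
  moreover have "U * (U' * (c * W * r') + L * V) = D"
  proof -
    have "c * W * r' \<in> carrier_mat n n" using G(1-4) c by auto
    from mult_inverse_cancel(1)[OF IH(1) this]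
    have "U * (U' * (c * W * r') + L * V) = c * W * r' + D'"
      using G(1-4) c UV IH(3,8)
      by (simp add: mult_add_distrib_mat[of _ n n _ n] assoc_mult_mat[of _ n n _ n _ n])
    then show ?thesis using D'_add by simp
  qed
  ultimately have UX: "U * (U' * c) = c" "U * (U' * (c * W * r') + L * V) = D"
    by auto
  have neg: "- (e * U) * X = - (e * (U * X))" if "X \<in> carrier_mat n m" for X m
  proof -
    have "- (e * U) * X = - (e * U * X)"
      using c UV that by (intro uminus_mult_left_mat) auto
    also have "e * U * X = e * (U * X)"
      using c(1) UV(1) that by (rule assoc_mult_mat)
    finally show ?thesis .
  qed
  have "U' * c \<in> carrier_mat n 1" "U' * (c * W * r') + L * V \<in> carrier_mat n n"
    using G(1-4) c UV IH(3) by auto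
  from neg[OF this(1)] neg[OF this(2)]
  have *: "- (e * U) * (U' * c) = - (e * c)"
    "- (e * U) * (U' * (c * W * r') + L * V) = - (e * D)"
    unfolding UX .
  have "u + - (e * c) = a" "r' + - (e * D) = r"
    unfolding u_def r'_def using G(1-4) c by (auto intro!: eq_matI)
  then have "U1 * (L1 * V1) = four_block_mat a r c D"
    unfolding LV U1_def using G(1-4) c UV IH(3) * UX
    by (simp add: mult_four_block_mat[of _ 1 1 _ n _ n _ _ 1 _ n] del: One_nat_def)
  then have "G = U1 * L1 * V1"
    using G(5) L1c U1 V1 unfolding inverse_mats_def
    by (simp add: assoc_mult_mat[of _ "1 + n" "1 + n" _ "1 + n" _ "1 + n"] del: One_nat_def)
  then show ?case
    using U1 V1 tri1 tri2 L1c L1_diag L1_lower by (metis plus_1_eq_Suc)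
qed

section \<open>Triangularization over K-Hermite rings\<close>

text \<open>Column operations sweep the row into its last entry, where the bottom row of an upper
  triangular matrix needs it. By induction all but the last entry of the initial segment are
  cleared; a \<open>2 x 2\<close> step then treats the two remaining entries.\<close>

lemma K_Hermite_row:
  fixes r :: "'a::ring_1 mat"
  assumes herm: "right_K_Hermite TYPE('a)"
  shows "r \<in> carrier_mat 1 (Suc n) \<Longrightarrow>
    \<exists>G H. inverse_mats (Suc n) G H \<and> (\<forall>j<n. (r * G) $$ (0, j) = 0)"
proof (induction n arbitrary: r)
  case 0
  have "inverse_mats (Suc 0) (1\<^sub>m (Suc 0)) (1\<^sub>m (Suc 0) :: 'a mat)"
    unfolding inverse_mats_def by auto
  then show ?case by blast
next
  case (Suc n)
  have one: "inverse_mats m (1\<^sub>m m) (1\<^sub>m m :: 'a mat)" for m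
    unfolding inverse_mats_def by auto
  obtain s x a b where sp: "split_block r 1 (Suc n) = (s, x, a, b)"
    by (cases "split_block r 1 (Suc n)") auto
  \<comment> \<open>The row is viewed as a block matrix whose lower blocks have zero rows, so that
    block multiplication applies.\<close>
  have "dim_row r = 1 + 0" "dim_col r = Suc n + 1"
    using Suc.prems by auto
  note r = split_block[OF sp this]
  obtain G H where G: "inverse_mats (Suc n) G H" and sG: "\<And>j. j < n \<Longrightarrow> (s * G) $$ (0, j) = 0"
    using Suc.IH[OF r(1)] by blast
  have Gc: "G \<in> carrier_mat (Suc n) (Suc n)"
    using G unfolding inverse_mats_def by auto
  define G1 where "G1 = four_block_mat G (0\<^sub>m (Suc n) 1) (0\<^sub>m 1 (Suc n)) (1\<^sub>m 1)"
  obtain H1 where G1: "inverse_mats (Suc n + 1) G1 H1"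
    using inverse_mats_upper_block[OF G one[of 1], of "0\<^sub>m (Suc n) 1"] unfolding G1_def by auto
  have "r * G1 = four_block_mat (s * G) x (a * G) b"
    unfolding G1_def r(5) using r(1-4) Gc
    by (simp add: mult_four_block_mat[of _ 1 "Suc n" _ 1 _ 0 _ _ "Suc n" _ 1] del: One_nat_def)
  then have rG1: "(r * G1) $$ (0, j) = 0" if "j < n" for j
    using that r(1-4) Gc sG by simp
  define r1 where "r1 = r * G1"
  have r1c: "r1 \<in> carrier_mat 1 (n + 2)"
    unfolding r1_def using Suc.prems G1 unfolding inverse_mats_def by auto
  obtain v y a' b' where sp': "split_block r1 1 n = (v, y, a', b')"
    by (cases "split_block r1 1 n") auto
  have "dim_row r1 = 1 + 0" "dim_col r1 = n + 2"
    using r1c by auto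
  note r1 = split_block[OF sp' this]
  have "v = mat 1 n (\<lambda>ij. r1 $$ ij)"
    using sp' unfolding split_block_def Let_def by simp
  then have v0: "v = 0\<^sub>m 1 n"
    using rG1 unfolding r1_def[symmetric] by (auto intro!: eq_matI)
  have y: "y = mat_of_rows_list 2 [[y $$ (0, 0), y $$ (0, 1)]]"
    using r1(2) by (intro eq_matI) (auto simp: mat_of_rows_list_def less_2_cases_iff)
  obtain Q z where Q: "Q \<in> GL_mat 2" and "y * Q = mat_of_rows_list 2 [[z, 0]]"
    using herm y unfolding right_K_Hermite_def by metis
  then have yQ: "(y * Q) $$ (0, 1) = 0"
    by (simp add: mat_of_rows_list_def)
  obtain Q' where Q': "inverse_mats 2 Q Q'"
    using Q unfolding GL_mat_iff by auto
  \<comment> \<open>The Hermite condition leaves \<open>z\<close> in the first place; the swap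
    \<open>S\<close> moves it to the last.\<close>
  define S :: "'a mat" where "S = mat 2 2 (\<lambda>(i, j). if i = j then 0 else 1)"
  have S: "inverse_mats 2 S S"
    unfolding inverse_mats_def S_def
    by (auto intro!: eq_matI simp: scalar_prod_def less_2_cases_iff numeral_2_eq_2)
  have QS: "inverse_mats 2 (Q * S) (S * Q')"
    by (rule inverse_mats_mult[OF Q' S])
  have QSc: "Q \<in> carrier_mat 2 2" "S \<in> carrier_mat 2 2"
    using Q' S unfolding inverse_mats_def by auto
  have yQS: "(y * (Q * S)) $$ (0, 0) = 0"
  proof -
    have "y * (Q * S) = y * Q * S"
      using r1(2) QSc by (simp add: assoc_mult_mat[of _ 1 2 _ 2 _ 2])
    also have "(y * Q * S) $$ (0, 0) = (\<Sum>k<2. (y * Q) $$ (0, k) * S $$ (k, 0))"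
      using r1(2) QSc by (intro mult_mat_entry) auto
    also have "\<dots> = 0"
      using yQ by (simp add: numeral_2_eq_2 S_def)
    finally show ?thesis .
  qed
  define G2 where "G2 = four_block_mat (1\<^sub>m n) (0\<^sub>m n 2) (0\<^sub>m 2 n) (Q * S)"
  obtain H2 where G2: "inverse_mats (n + 2) G2 H2"
    using inverse_mats_upper_block[OF one[of n] QS, of "0\<^sub>m n 2"] unfolding G2_def by auto
  have "r1 * G2 = four_block_mat v (y * (Q * S)) a' (b' * (Q * S))"
    unfolding G2_def r1(5) using r1(1-4) QSc
    by (simp add: mult_four_block_mat[of _ 1 n _ 2 _ 0 _ _ n _ 2] del: One_nat_def)
  then have "(r1 * G2) $$ (0, j) = 0" if "j < Suc n" for j
    using that r1(1-4) QSc v0 yQS by (cases "j = n") auto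
  moreover have "r1 * G2 = r * (G1 * G2)"
    unfolding r1_def using Suc.prems G1 G2 unfolding inverse_mats_def
    by (intro assoc_mult_mat[of _ 1 "n + 2" _ "n + 2" _ "n + 2"]) auto
  moreover have "inverse_mats (n + 2) (G1 * G2) (H2 * H1)"
    using G1 G2 by (intro inverse_mats_mult) auto
  ultimately show ?case by (metis add_2_eq_Suc')
qed

text \<open>Clear the last row up to its final entry by an invertible \<open>G\<close> on the right,
  then apply the induction hypothesis to the upper left block.\<close>

lemma K_Hermite_upper_triangular:
  fixes M :: "'a::ring_1 mat"
  assumes herm: "right_K_Hermite TYPE('a)"
  shows "M \<in> carrier_mat n n \<Longrightarrow>
    \<exists>T G H. T \<in> carrier_mat n n \<and> upper_triangular T \<and> inverse_mats n G H \<and> M = T * G"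
proof (induction n arbitrary: M)
  case 0
  then have "M = 1\<^sub>m 0" by auto
  then show ?case
    by (intro exI[of _ "1\<^sub>m 0"]) (auto simp: inverse_mats_def)
next
  case (Suc n)
  have one: "inverse_mats 1 (1\<^sub>m 1) (1\<^sub>m 1 :: 'a mat)"
    unfolding inverse_mats_def by auto
  define r where "r = mat 1 (Suc n) (\<lambda>(i, j). M $$ (n, j))"
  have rc: "r \<in> carrier_mat 1 (Suc n)" unfolding r_def by simp
  obtain G H where G: "inverse_mats (n + 1) G H" and rG: "\<And>j. j < n \<Longrightarrow> (r * G) $$ (0, j) = 0"
    using K_Hermite_row[OF herm rc] by auto
  have Gc: "G \<in> carrier_mat (n + 1) (n + 1)" "H \<in> carrier_mat (n + 1) (n + 1)"
    using G unfolding inverse_mats_def by auto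
  have MG: "(M * G) $$ (n, j) = 0" if "j < n" for j
  proof -
    have "(M * G) $$ (n, j) = (r * G) $$ (0, j)"
      using that Gc Suc.prems by (simp add: r_def scalar_prod_def)
    then show ?thesis using rG that by simp
  qed
  obtain A B C D where sp: "split_block (M * G) n n = (A, B, C, D)"
    by (cases "split_block (M * G) n n") auto
  have "dim_row (M * G) = n + 1" "dim_col (M * G) = n + 1"
    using Suc.prems Gc by auto
  note MG' = split_block[OF sp this]
  have "C = mat 1 n (\<lambda>(i, j). (M * G) $$ (i + n, j))"
    using sp Suc.prems Gc unfolding split_block_def Let_def by (auto simp del: index_mult_mat(1))
  then have C0: "C = 0\<^sub>m 1 n"
    using MG by (auto simp del: index_mult_mat(1) intro!: eq_matI)
  obtain T g h where T: "T \<in> carrier_mat n n" "upper_triangular T" and g: "inverse_mats n g h"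
    and A: "A = T * g"
    using Suc.IH[OF MG'(1)] by blast
  have gc: "g \<in> carrier_mat n n"
    using g unfolding inverse_mats_def by auto
  \<comment> \<open>Bordering \<open>g\<close> by 1 leaves the last column of \<open>M * G\<close>
    unchanged, so \<open>B\<close> and \<open>D\<close> enter \<open>T1\<close> as they are.\<close>
  define g1 where "g1 = four_block_mat g (0\<^sub>m n 1) (0\<^sub>m 1 n) (1\<^sub>m 1)"
  obtain h1 where g1: "inverse_mats (n + 1) g1 h1"
    using inverse_mats_upper_block[OF g one, of "0\<^sub>m n 1"] unfolding g1_def by auto
  have g1c: "g1 \<in> carrier_mat (n + 1) (n + 1)"
    using g1 unfolding inverse_mats_def by auto
  define T1 where "T1 = four_block_mat T B (0\<^sub>m 1 n) D"
  have T1c: "T1 \<in> carrier_mat (n + 1) (n + 1)"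
    unfolding T1_def by (rule four_block_carrier_mat[OF T(1) MG'(4)])
  have T1: "upper_triangular T1"
    unfolding T1_def by (rule upper_triangular_four_block) (use T MG'(1-4) in auto)
  have "M * G = T1 * g1"
    unfolding MG'(5) C0 T1_def g1_def A using T MG'(1-4) gc
    by (simp add: mult_four_block_mat[of _ n n _ 1 _ 1 _ _ n _ 1] del: One_nat_def)
  moreover have "M * G * H = M"
    using G Gc Suc.prems unfolding inverse_mats_def
    by (simp add: assoc_mult_mat[of _ "Suc n" "Suc n" _ "Suc n" _ "Suc n"])
  ultimately have "M = T1 * (g1 * H)"
    using T1c g1c Gc by (simp add: assoc_mult_mat[of _ "Suc n" "Suc n" _ "Suc n" _ "Suc n"])
  moreover have "inverse_mats (n + 1) (g1 * H) (G * h1)"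
    by (rule inverse_mats_mult[OF g1 inverse_mats_sym[OF G]])
  ultimately show ?case using T1 T1c by (metis Suc_eq_plus1)
qed

section \<open>Assembling the factorizations\<close>

lemma upper_triangular_mult:
  fixes S T :: "'a::ring_1 mat"
  assumes "S \<in> carrier_mat n n" "T \<in> carrier_mat n n" "upper_triangular S" "upper_triangular T"
  shows "upper_triangular (S * T)"
proof (rule upper_triangularI)
  fix i j assume ij: "j < i" "i < dim_row (S * T)"
  then have "(S * T) $$ (i, j) = (\<Sum>k<n. S $$ (i, k) * T $$ (k, j))"
    using assms by (intro mult_mat_entry[of _ n n _ n]) auto
  also have "\<dots> = 0"
  proof (rule sum.neutral, rule ballI)
    fix k assume "k \<in> {..<n}"
    then show "S $$ (i, k) * T $$ (k, j) = 0"
      using upper_triangularD[OF assms(3), of k i] upper_triangularD[OF assms(4), of j k] ij assms(1,2)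
      by (cases "k < i") auto
  qed
  finally show "(S * T) $$ (i, j) = 0" .
qed

text \<open>With \<open>G = U * L * V\<close>, conjugating \<open>T * G\<close> by \<open>V\<close>
  moves the right-hand factor to the front and gives \<open>(V * T * U) * L\<close>, upper
  triangular times lower unitriangular.\<close>

lemma (in unital_algebra) upper_times_GL_three_commutators:
  fixes T :: "'a mat"
  assumes inf: "infinite (UNIV :: 'k set)" and sr: "bass_stable_rank_one TYPE('a)" and n: "n \<ge> 3"
    and T: "T \<in> carrier_mat n n" "upper_triangular T" and G: "inverse_mats n G H"
  shows "product_of_three_commutators n (T * G)"
proof -
  obtain U U' L V V' where UV: "inverse_mats n U U'" "upper_triangular U" "L \<in> carrier_mat n n"
    "\<And>i. i < n \<Longrightarrow> L $$ (i, i) = 1" "\<And>i j. i < j \<Longrightarrow> j < n \<Longrightarrow> L $$ (i, j) = 0"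
    "inverse_mats n V V'" "upper_triangular V" "G = U * L * V"
    using GL_upper_lower_upper[OF sr G] by blast
  have c: "U \<in> carrier_mat n n" "V \<in> carrier_mat n n" "V' \<in> carrier_mat n n"
    using UV unfolding inverse_mats_def by auto
  have "upper_triangular (V * T * U)"
    using c T UV by (intro upper_triangular_mult[of _ n]) auto
  then have "product_of_three_commutators n (V * T * U * L)"
    using c T UV by (intro upper_times_lower_three_commutators[OF inf n]) auto
  from product_of_three_commutators_conj[OF inverse_mats_sym[OF UV(6)] this]
  have "product_of_three_commutators n (V' * (V * T * U * L) * V)" .
  also have "V' * (V * T * U * L) * V = V' * (V * (T * (U * (L * V))))"
    using c T UV(3) by (simp add: assoc_mult_mat[of _ n n _ n _ n])
  also have "\<dots> = T * (U * (L * V))"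
    using mult_inverse_cancel(2)[OF UV(6), of "T * (U * (L * V))" n] c T UV(3) by auto
  also have "\<dots> = T * G"
    using c T UV(3) by (simp add: UV(8) assoc_mult_mat[of _ n n _ n _ n])
  finally show ?thesis .
qed

theorem theoremB:
  fixes scale :: "'k::field \<Rightarrow> 'a::ring_1 \<Rightarrow> 'a"
    and n :: nat
  assumes "unital_algebra scale"
    and "infinite (UNIV :: 'k set)"
    and "bass_stable_rank_one TYPE('a)"
    and "n \<ge> 3"
  shows "(\<forall>M \<in> (GL_mat n :: 'a mat set). product_of_three_commutators n M) \<and>
    (right_K_Hermite TYPE('a) \<longrightarrow>
      (\<forall>M \<in> (carrier_mat n n :: 'a mat set). product_of_three_commutators n M))"
proof (intro conjI ballI impI)
  note main = unital_algebra.upper_times_GL_three_commutators[OF assms]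
  fix M :: "'a mat"
  {
    assume "M \<in> GL_mat n"
    then obtain N where N: "inverse_mats n M N"
      unfolding GL_mat_iff by auto
    then have "M \<in> carrier_mat n n"
      unfolding inverse_mats_def by blast
    \<comment> \<open>An invertible matrix is the case where the upper triangular factor is the
      identity.\<close>
    then have "1\<^sub>m n * M = M"
      by simp
    then show "product_of_three_commutators n M"
      using main[OF one_carrier_mat upper_triangular_one N] by simp
  }
  assume "right_K_Hermite TYPE('a)" "M \<in> carrier_mat n n"
  from K_Hermite_upper_triangular[OF this] show "product_of_three_commutators n M"
    using main by blast
qed

end
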